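(* Let $G=(\mathcal{V},\mathcal{E})$ be an undirected graph with $\mathcal{V}=\{1,\dots,n\}$, let $\mathcal{K}\subseteq\mathbb{R}^n$ be a nonempty closed convex cone, let $\mathcal{A}_G:\mathcal{S}(G)\to\mathbb{R}^m$ be a linear map and let $\mathbf{b}\in\mathbb{R}^m$. Assume that for all $\mathsf{C}_G\in\mathcal{S}(G)$ $$\inf_{\mathsf{X}_G\in\mathcal{S}(G)}\{\mathsf{C}_G\bullet\mathsf{X}_G:\mathcal{A}_G(\mathsf{X}_G)=\mathbf{b},\ \mathsf{X}_G\in\mathcal{CCP}_G(\mathcal{K})\}=\inf_{\mathsf{X}_G\in\mathcal{S}(G)}\{\mathsf{C}_G\bullet\mathsf{X}_G:\mathcal{A}_G(\mathsf{X}_G)=\mathbf{b},\ \mathsf{X}_G\in\mathcal{PCP}_G(\mathcal{K})\}.$$ Then for every $\mathsf{X}_G\in\mathcal{S}(G)$, $\mathcal{A}_G(\mathsf{X}_G)=\mathbf{b}$ and $\mathsf{X}_G\in\mathcal{PCP}_G(\mathcal{K})$ imply $\mathsf{X}_G\in\mathcal{CCP}_G(\mathcal{K})$.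
   Context: $\mathcal{CPP}(\mathcal{K})=\mathrm{conv}\{\mathbf{x}\mathbf{x}^{\mathsf T}:\mathbf{x}\in\mathcal{K}\}$ is the set-completely positive matrix cone in the space of real symmetric $n\times n$ matrices. A symmetric partial matrix with specification graph $G$ is a symmetric $n\times n$ array whose $(i,j)$ entry is specified (a real number) if and only if $\{i,j\}\in\mathcal{E}$ or $i=j$; other entries are unspecified. $\mathcal{S}(G)$ is the vector space of all such partial matrices (operations on the specified entries), equipped with the product $\mathsf{A}_G\bullet\mathsf{B}_G=2\sum_{\{i,j\}\in\mathcal{E},\,i\neq j}(\mathsf{A}_G)_{ij}(\mathsf{B}_G)_{ij}+\sum_{i=1}^n(\mathsf{A}_G)_{ii}(\mathsf{B}_G)_{ii}$. $\mathcal{CCP}_G(\mathcal{K})$ is the set of $\mathsf{M}_G\in\mathcal{S}(G)$ whose unspecified entries can be assigned real values so that the resulting full symmetric matrix lies in $\mathcal{CPP}(\mathcal{K})$. $\mathcal{PCP}_G(\mathcal{K})$ is the set of $\mathsf{M}_G\in\mathcal{S}(G)$ such that every fully specified principal submatrix of $\mathsf{M}_G$ is equal to the principal submatrix, induced by the same rows and columns, of some matrix in $\mathcal{CPP}(\mathcal{K})$. Infima are taken in $\mathbb{R}\cup\{\pm\infty\}$, with the infimum over the empty set equal to $+\infty$. *)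

theory Defs
  imports "HOL-Analysis.Analysis"
begin

(* Vertices are the elements of the finite type 'n. Loops are allowed; they have no influence
   on the notions below, since diagonal entries are specified in any case. *)
definition undirected_graph :: "'n::finite set set \<Rightarrow> bool" where
  "undirected_graph E \<longleftrightarrow> (\<forall>e\<in>E. \<exists>i j. e = {i, j})"

definition CPP :: "(real ^ 'n) set \<Rightarrow> (real ^ 'n ^ 'n) set" where
  "CPP K = convex hull {(\<chi> i j. x $ i * x $ j) | x. x \<in> K}"

(* None marks an unspecified entry. *)
type_synonym 'n partial_matrix = "'n \<Rightarrow> 'n \<Rightarrow> real option"

definition partial_matrices :: "'n::finite set set \<Rightarrow> 'n partial_matrix set" where
  "partial_matrices E =
     {M. (\<forall>i j. M i j \<noteq> None \<longleftrightarrow> {i, j} \<in> E \<or> i = j) \<and> (\<forall>i j. M i j = M j i)}"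

definition pm_add :: "'n partial_matrix \<Rightarrow> 'n partial_matrix \<Rightarrow> 'n partial_matrix" where
  "pm_add A B = (\<lambda>i j. case (A i j, B i j) of (Some a, Some b) \<Rightarrow> Some (a + b) | _ \<Rightarrow> None)"

definition pm_scale :: "real \<Rightarrow> 'n partial_matrix \<Rightarrow> 'n partial_matrix" where
  "pm_scale c A = (\<lambda>i j. map_option (\<lambda>a. c * a) (A i j))"

definition pm_linear :: "'n::finite set set \<Rightarrow> ('n partial_matrix \<Rightarrow> 'v::real_vector) \<Rightarrow> bool" where
  "pm_linear E f \<longleftrightarrow>
     (\<forall>X\<in>partial_matrices E. \<forall>Y\<in>partial_matrices E. f (pm_add X Y) = f X + f Y) \<and>
     (\<forall>c. \<forall>X\<in>partial_matrices E. f (pm_scale c X) = c *\<^sub>R f X)"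

(* The first sum runs over ordered pairs, so every edge {i, j} with i \<noteq> j is counted twice;
   for symmetric A and B this is the factor 2 in the product on partial matrices. *)
definition pm_inner :: "'n::finite set set \<Rightarrow> 'n partial_matrix \<Rightarrow> 'n partial_matrix \<Rightarrow> real" where
  "pm_inner E A B =
     (\<Sum>(i, j)\<in>{(i, j). {i, j} \<in> E \<and> i \<noteq> j}. the (A i j) * the (B i j)) +
     (\<Sum>i\<in>UNIV. the (A i i) * the (B i i))"

definition CCP :: "'n::finite set set \<Rightarrow> (real ^ 'n) set \<Rightarrow> 'n partial_matrix set" where
  "CCP E K = {M \<in> partial_matrices E.
     \<exists>X. transpose X = X \<and> (\<forall>i j. M i j \<noteq> None \<longrightarrow> M i j = Some (X $ i $ j)) \<and> X \<in> CPP K}"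

(* I is the index set of a principal submatrix. *)
definition PCP :: "'n::finite set set \<Rightarrow> (real ^ 'n) set \<Rightarrow> 'n partial_matrix set" where
  "PCP E K = {M \<in> partial_matrices E.
     \<forall>I. (\<forall>i\<in>I. \<forall>j\<in>I. M i j \<noteq> None) \<longrightarrow>
         (\<exists>X\<in>CPP K. \<forall>i\<in>I. \<forall>j\<in>I. M i j = Some (X $ i $ j))}"

end

theory Submission
  imports Defs
begin

text \<open>
  The feasible set of the completable problem is closed and convex; hence a partial matrix outside
  it is strictly separated from it by a linear functional, and every linear functional on partial
  matrices has the form \<open>X \<mapsto> C \<bullet> X\<close>. If \<open>X\<close> were feasible for the problem over \<^const>\<open>PCP\<close> but
  not in \<^const>\<open>CCP\<close>, the separating \<open>C\<close> would give a strictly smaller infimum over \<^const>\<open>PCP\<close>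
  than over \<^const>\<open>CCP\<close>. This covers the case that no completable matrix is feasible, the second
  infimum being then \<open>\<infinity>\<close>.

  The point that needs care is closedness. Filling unspecified entries with zeros turns partial
  matrices into ordinary ones and \<^const>\<open>CCP\<close> into the image of \<^const>\<open>CPP\<close> under a linear
  masking map (\<open>CCP_iff_masked\<close>). Linear images of closed cones need not be closed, but \<^const>\<open>CPP\<close>
  is generated by the compact convex hull of the matrices \<open>x x\<^sup>T\<close> with \<open>x \<in> K\<close> a unit vector
  (\<open>CPP_eq_conic_hull\<close>). These have trace \<open>1\<close>, and masking keeps the diagonal, so that the image
  of this hull is a compact set that misses the origin, and the cone over such a set is closed
  (\<open>closed_masked_CPP\<close>).
\<close>

section \<open>Partial matrices as ordinary matrices\<close>

text \<open>The ordinary matrix of a partial matrix, with zeros for the unspecified entries.\<close>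

definition mat_of :: "'n::finite partial_matrix \<Rightarrow> real ^ 'n ^ 'n" where
  "mat_of X = (\<chi> i j. if X i j = None then 0 else the (X i j))"

text \<open>The partial matrix that retains the specified entries of an ordinary matrix.\<close>

definition pm_of :: "'n::finite set set \<Rightarrow> real ^ 'n ^ 'n \<Rightarrow> 'n partial_matrix" where
  "pm_of E M = (\<lambda>i j. if {i, j} \<in> E \<or> i = j then Some (M $ i $ j) else None)"

text \<open>The linear map that replaces the unspecified entries by zeros.\<close>

definition masked :: "'n::finite set set \<Rightarrow> real ^ 'n ^ 'n \<Rightarrow> real ^ 'n ^ 'n" where
  "masked E M = (\<chi> i j. if {i, j} \<in> E \<or> i = j then M $ i $ j else 0)"

text \<open>The symmetric part of a matrix.\<close>

definition symm :: "real ^ 'n ^ 'n \<Rightarrow> real ^ 'n::finite ^ 'n" where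
  "symm M = (1 / 2) *\<^sub>R (M + transpose M)"

lemma linear_masked: "linear (masked E)"
  by (rule linearI) (auto simp: masked_def vec_eq_iff)

lemma transpose_symm [simp]: "transpose (symm M) = symm M"
  by (simp add: symm_def transpose_def vec_eq_iff)

lemma symm_of_symmetric: "transpose M = M \<Longrightarrow> symm M = M"
  by (simp add: symm_def flip: scaleR_2)

lemma pm_of_in_partial_matrices: "transpose M = M \<Longrightarrow> pm_of E M \<in> partial_matrices E"
  by (auto simp: pm_of_def partial_matrices_def transpose_def vec_eq_iff insert_commute)

lemma unspecified_iff:
  assumes "X \<in> partial_matrices E"
  shows "X i j = None \<longleftrightarrow> {i, j} \<notin> E \<and> i \<noteq> j"
  using assms unfolding partial_matrices_def by blast

lemma partial_matrices_sym: "X \<in> partial_matrices E \<Longrightarrow> X i j = X j i"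
  unfolding partial_matrices_def by blast

lemma pm_of_mat_of: "X \<in> partial_matrices E \<Longrightarrow> pm_of E (mat_of X) = X"
proof (intro ext)
  fix i j assume "X \<in> partial_matrices E"
  then show "pm_of E (mat_of X) i j = X i j"
    using unspecified_iff[of X E i j] by (cases "X i j") (auto simp: pm_of_def mat_of_def)
qed

lemma transpose_mat_of: "X \<in> partial_matrices E \<Longrightarrow> transpose (mat_of X) = mat_of X"
  by (simp add: mat_of_def transpose_def vec_eq_iff partial_matrices_sym[of X E])

lemma mat_of_eq_masked_iff:
  assumes "X \<in> partial_matrices E"
  shows "mat_of X = masked E M \<longleftrightarrow> (\<forall>i j. X i j \<noteq> None \<longrightarrow> X i j = Some (M $ i $ j))"
proof -
  have "mat_of X $ i $ j = masked E M $ i $ j \<longleftrightarrow> (X i j \<noteq> None \<longrightarrow> X i j = Some (M $ i $ j))" for i j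
    using unspecified_iff[OF assms, of i j] by (cases "X i j") (auto simp: mat_of_def masked_def)
  then show ?thesis
    by (simp only: vec_eq_iff)
qed

text \<open>
  The zeros of \<^const>\<open>mat_of\<close> cancel the entries of \<open>M\<close> at unspecified positions, so \<open>M\<close> need not
  be masked.
\<close>

lemma pm_inner_pm_of:
  assumes "X \<in> partial_matrices E"
  shows "pm_inner E (pm_of E M) X = inner M (mat_of X)"
proof -
  let ?f = "\<lambda>i j. M $ i $ j * mat_of X $ i $ j"
  have off: "(\<Sum>(i, j)\<in>{(i, j). {i, j} \<in> E \<and> i \<noteq> j}. the (pm_of E M i j) * the (X i j))
      = (\<Sum>(i, j)\<in>{(i, j). i \<noteq> j}. ?f i j)"
    by (rule sum.mono_neutral_cong_left) (auto simp: pm_of_def mat_of_def unspecified_iff[OF assms] split: if_splits)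
  have diag: "(\<Sum>i\<in>UNIV. the (pm_of E M i i) * the (X i i)) = (\<Sum>(i, j)\<in>{(i, j). i = j}. ?f i j)"
    by (rule sum.reindex_bij_witness[where i = fst and j = "\<lambda>i. (i, i)"])
      (auto simp: pm_of_def mat_of_def unspecified_iff[OF assms] split: if_splits)
  have "inner M (mat_of X) = (\<Sum>i\<in>UNIV. \<Sum>j\<in>UNIV. ?f i j)"
    by (simp add: inner_vec_def)
  also have "\<dots> = (\<Sum>(i, j)\<in>UNIV. ?f i j)"
    by (simp add: sum.cartesian_product)
  also have "UNIV = {(i, j). i \<noteq> j} \<union> {(i::'a, j). i = j}"
    by auto
  also have "(\<Sum>(i, j)\<in>\<dots>. ?f i j) =
      (\<Sum>(i, j)\<in>{(i, j). i \<noteq> j}. ?f i j) + (\<Sum>(i, j)\<in>{(i, j). i = j}. ?f i j)"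
    by (rule sum.union_disjoint) auto
  finally show ?thesis
    unfolding pm_inner_def off diag by simp
qed

text \<open>
  The normal vector of a hyperplane in the space of all matrices can be replaced by its symmetric
  part, as long as only symmetric matrices are tested.
\<close>

lemma inner_symm:
  assumes "transpose Y = Y"
  shows "inner (symm M) Y = inner M Y"
proof -
  have "inner (transpose M) Y = (\<Sum>i\<in>UNIV. \<Sum>j\<in>UNIV. M $ j $ i * Y $ i $ j)"
    by (simp add: inner_vec_def transpose_def)
  also have "\<dots> = (\<Sum>j\<in>UNIV. \<Sum>i\<in>UNIV. M $ j $ i * transpose Y $ j $ i)"
    by (subst sum.swap) (simp add: transpose_def)
  also have "\<dots> = inner M Y"
    by (simp add: assms inner_vec_def)
  finally show ?thesis
    by (simp add: symm_def inner_add_left)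
qed

text \<open>
  Composed with the symmetric part, a linear map on partial matrices extends to all matrices. This
  makes linear maps on the full matrix space, and in particular their continuity, applicable.
\<close>

lemma linear_pm_of_symm:
  assumes "pm_linear E f"
  shows "linear (\<lambda>M. f (pm_of E (symm M)))"
proof (rule linearI)
  fix M N :: "real ^ 'a ^ 'a" and c :: real
  have "pm_of E (symm (M + N)) = pm_add (pm_of E (symm M)) (pm_of E (symm N))"
    by (simp add: pm_of_def pm_add_def symm_def transpose_def fun_eq_iff algebra_simps)
  then show "f (pm_of E (symm (M + N))) = f (pm_of E (symm M)) + f (pm_of E (symm N))"
    using assms by (simp add: pm_linear_def pm_of_in_partial_matrices)
  have "pm_of E (symm (c *\<^sub>R M)) = pm_scale c (pm_of E (symm M))"
    by (simp add: pm_of_def pm_scale_def symm_def transpose_def fun_eq_iff algebra_simps)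
  then show "f (pm_of E (symm (c *\<^sub>R M))) = c *\<^sub>R f (pm_of E (symm M))"
    using assms by (simp add: pm_linear_def pm_of_in_partial_matrices)
qed

section \<open>The set-completely positive cone and its masked image\<close>

text \<open>The rank-one matrix \<open>x x\<^sup>T\<close>.\<close>

definition outer :: "real ^ 'n \<Rightarrow> real ^ 'n::finite ^ 'n" where
  "outer x = (\<chi> i j. x $ i * x $ j)"

lemma CPP_eq_hull_outer: "CPP K = convex hull (outer ` K)"
  unfolding CPP_def outer_def by (rule arg_cong[where f = "\<lambda>S. convex hull S"]) auto

lemma outer_scaleR: "outer (c *\<^sub>R x) = c\<^sup>2 *\<^sub>R outer x"
  by (simp add: outer_def vec_eq_iff power2_eq_square)

lemma trace_outer: "trace (outer x) = (norm x)\<^sup>2"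
  by (simp add: trace_def outer_def power2_norm_eq_inner inner_vec_def)

lemma transpose_CPP:
  assumes "M \<in> CPP K"
  shows "transpose M = M"
proof -
  have "convex {M :: real ^ 'a ^ 'a. transpose M = M}"
    by (auto simp: convex_def transpose_def vec_eq_iff)
  then have "CPP K \<subseteq> {M. transpose M = M}"
    unfolding CPP_eq_hull_outer
    by (intro hull_minimal) (auto simp: outer_def transpose_def mult.commute)
  then show ?thesis
    using assms by blast
qed

lemma CCP_iff_masked:
  assumes "X \<in> partial_matrices E"
  shows "X \<in> CCP E K \<longleftrightarrow> mat_of X \<in> masked E ` CPP K"
  using assms transpose_CPP by (auto simp: CCP_def image_iff mat_of_eq_masked_iff)

text \<open>
  The origin is added because for \<open>K = {0}\<close> there are no unit vectors and the conic hull is empty.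
\<close>

lemma CPP_eq_conic_hull:
  fixes K :: "(real ^ 'n::finite) set"
  assumes "cone K" "K \<noteq> {}"
  shows "CPP K = insert 0 (conic hull (convex hull (outer ` (K \<inter> sphere 0 1))))" (is "_ = ?R")
proof
  let ?C = "convex hull (outer ` (K \<inter> sphere 0 1))"
  have "outer x \<in> ?R" if "x \<in> K" for x
  proof (cases "x = 0")
    case True
    then show ?thesis by (simp add: outer_def vec_eq_iff)
  next
    case False
    let ?u = "(1 / norm x) *\<^sub>R x"
    have "?u \<in> K \<inter> sphere 0 1"
      using False that assms(1) by (simp add: mem_cone)
    then have "outer ?u \<in> ?C"
      by (intro hull_inc imageI)
    moreover have "outer x = (norm x)\<^sup>2 *\<^sub>R outer ?u"
      using False by (simp only: outer_scaleR) (simp add: power_divide)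
    ultimately show ?thesis
      unfolding conic_hull_explicit by (intro insertI2 CollectI exI conjI) auto
  qed
  moreover have "convex ?R"
  proof (cases "?C = {}")
    case True
    then show ?thesis by (simp only: conic_hull_eq_empty[THEN iffD2] convex_singleton)
  next
    case False
    then have "?R = conic hull ?C"
      by (simp only: conic_hull_contains_0 insert_absorb not_False_eq_True)
    then show ?thesis
      by (simp only: convex_conic_hull convex_convex_hull)
  qed
  ultimately show "CPP K \<subseteq> ?R"
    unfolding CPP_eq_hull_outer by (intro hull_minimal) auto
next
  let ?C = "convex hull (outer ` (K \<inter> sphere 0 1))"
  have "0 \<in> K"
    using assms cone_contains_0 by blast
  moreover have "outer (0 :: real ^ 'n) = 0"
    by (simp add: outer_def vec_eq_iff)
  ultimately have "0 \<in> CPP K"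
    unfolding CPP_eq_hull_outer by (metis hull_inc imageI)
  moreover have "c *\<^sub>R M \<in> CPP K" if "c \<ge> 0" "M \<in> ?C" for c M
  proof -
    have "(\<lambda>M. c *\<^sub>R M) ` outer ` (K \<inter> sphere 0 1) \<subseteq> outer ` K"
    proof clarify
      fix x assume "x \<in> K"
      then have "sqrt c *\<^sub>R x \<in> K" "outer (sqrt c *\<^sub>R x) = c *\<^sub>R outer x"
        using assms(1) that(1) by (auto simp: mem_cone outer_scaleR)
      then show "c *\<^sub>R outer x \<in> outer ` K"
        by (metis imageI)
    qed
    then have "(\<lambda>M. c *\<^sub>R M) ` ?C \<subseteq> CPP K"
      unfolding CPP_eq_hull_outer convex_hull_scaling[symmetric] by (rule hull_mono)
    then show ?thesis
      using that(2) by blast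
  qed
  ultimately show "?R \<subseteq> CPP K"
    by (auto simp: conic_hull_explicit)
qed

lemma closed_masked_CPP:
  fixes K :: "(real ^ 'n::finite) set"
  assumes "cone K" "closed K" "K \<noteq> {}"
  shows "closed (masked E ` CPP K)"
proof -
  let ?C = "convex hull (outer ` (K \<inter> sphere 0 1))"
  have "continuous_on (K \<inter> sphere 0 1) (outer :: real ^ 'n \<Rightarrow> _)"
    unfolding outer_def by (intro continuous_intros)
  moreover have "compact (K \<inter> sphere 0 1)"
    using assms(2) by (intro closed_Int_compact compact_sphere)
  ultimately have "compact ?C"
    by (intro compact_convex_hull compact_continuous_image)
  then have "compact (masked E ` ?C)"
    using linear_masked
    by (intro compact_continuous_image linear_continuous_on linear_conv_bounded_linear[THEN iffD1])
  moreover have "0 \<notin> masked E ` ?C"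
  proof
    have "convex {M :: real ^ 'n ^ 'n. trace M = 1}"
      by (auto simp: convex_def trace_def sum.distrib simp flip: sum_distrib_left)
    then have "?C \<subseteq> {M. trace M = 1}"
      by (intro hull_minimal) (auto simp: trace_outer)
    moreover have "trace (masked E M) = trace M" for M
      by (simp add: trace_def masked_def)
    moreover assume "0 \<in> masked E ` ?C"
    ultimately have "trace (0 :: real ^ 'n ^ 'n) = 1"
      by (metis (mono_tags, lifting) imageE mem_Collect_eq subsetD)
    then show False
      by (simp add: trace_def)
  qed
  ultimately have "closed (insert 0 (conic hull (masked E ` ?C)))"
    by (intro closed_insert closed_conic_hull) blast
  also have "insert 0 (conic hull (masked E ` ?C)) = masked E ` CPP K"
    by (simp add: CPP_eq_conic_hull assms conic_hull_linear_image linear_masked linear_0)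
  finally show ?thesis .
qed

lemma convex_masked_CPP: "convex (masked E ` CPP K)"
  unfolding CPP_eq_hull_outer by (intro convex_linear_image linear_masked convex_convex_hull)

section \<open>Separation\<close>

theorem theorem5:
  fixes E :: "'n::finite set set"
    and K :: "(real ^ 'n) set"
    and \<A> :: "'n partial_matrix \<Rightarrow> real ^ 'm"
    and b :: "real ^ 'm"
  assumes "undirected_graph E"
    and "K \<noteq> {}" and "closed K" and "convex K" and "cone K"
    and "pm_linear E \<A>"
    and "\<forall>C\<in>partial_matrices E.
          (INF X\<in>{X \<in> partial_matrices E. \<A> X = b \<and> X \<in> CCP E K}. ereal (pm_inner E C X)) =
          (INF X\<in>{X \<in> partial_matrices E. \<A> X = b \<and> X \<in> PCP E K}. ereal (pm_inner E C X))"
  shows "\<forall>X\<in>partial_matrices E. \<A> X = b \<and> X \<in> PCP E K \<longrightarrow> X \<in> CCP E K"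
proof (intro ballI impI, elim conjE, rule ccontr)
  fix X assume X: "X \<in> partial_matrices E" "\<A> X = b" "X \<in> PCP E K" "X \<notin> CCP E K"
  define L where "L = (\<lambda>M. \<A> (pm_of E (symm M)))"
  have "linear L"
    unfolding L_def by (rule linear_pm_of_symm) fact
  have L_mat_of: "L (mat_of Y) = \<A> Y" if "Y \<in> partial_matrices E" for Y
    using that by (simp add: L_def symm_of_symmetric transpose_mat_of pm_of_mat_of)
  define S where "S = masked E ` CPP K \<inter> L -` {b}"
  have "closed S"
    unfolding S_def using assms \<open>linear L\<close>
    by (intro closed_Int closed_masked_CPP closed_vimage linear_continuous_on)
       (auto simp: linear_conv_bounded_linear)
  moreover have "convex S"
    unfolding S_def using \<open>linear L\<close>
    by (intro convex_Int convex_masked_CPP convex_linear_vimage) auto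
  moreover have "mat_of X \<notin> S"
    using X by (simp add: S_def CCP_iff_masked)
  ultimately obtain a \<beta> where a: "inner a (mat_of X) < \<beta>" "\<And>M. M \<in> S \<Longrightarrow> \<beta> < inner a M"
    by (metis separating_hyperplane_closed_point)
  define C where "C = pm_of E (symm a)"
  have C: "C \<in> partial_matrices E"
    unfolding C_def by (intro pm_of_in_partial_matrices transpose_symm)
  have C_inner: "pm_inner E C Y = inner a (mat_of Y)" if "Y \<in> partial_matrices E" for Y
    using that by (simp add: C_def pm_inner_pm_of inner_symm transpose_mat_of)
  have "ereal \<beta> \<le> (INF Y\<in>{Y \<in> partial_matrices E. \<A> Y = b \<and> Y \<in> CCP E K}. ereal (pm_inner E C Y))"
    by (intro INF_greatest)
       (auto simp: C_inner CCP_iff_masked L_mat_of S_def intro!: less_imp_le a)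
  also have "\<dots> = (INF Y\<in>{Y \<in> partial_matrices E. \<A> Y = b \<and> Y \<in> PCP E K}. ereal (pm_inner E C Y))"
    using assms(7) C by blast
  also have "\<dots> \<le> ereal (pm_inner E C X)"
    using X by (intro INF_lower) auto
  finally show False
    using a(1) X(1) by (simp add: C_inner)
qed

end
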